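(* Let $\mu,\sigma,(X_k)_k,L,k_1<\dots<k_{L+1},\psi,\gamma$ and the random sample sizes $(N_n)_{n\ge 1}$ be as in the context. Let $\xi$ be a standard normally distributed random variable and let $\widehat{\mu}_{N_n} = K_{N_n}/N_n$ be the sample mean, where $K_m=\sum_{k=1}^m X_k$. Then $$d_{TV}\left(\xi,\frac{\sqrt{N_n}}{\sigma}\left(\widehat{\mu}_{N_n} - \mu\right)\right) \to 0 \text{ as } n \to \infty$$ in each of the following cases: (A) $\gamma > 1$ and $\psi$ has a finite limit in $0$; (B) $\gamma = 1$ and $\psi$ has a finite limit in $\mu$; (C)(1) $1/2 < \gamma < 1$, $\mu \neq 0$, and $\psi$ has finite limits in $-\infty$ and $\infty$; (C)(2) $1/2 < \gamma < 1$, $\mu = 0$, and $\psi$ has a finite limit in $0$; (D) $\gamma = 1/2$, $\mu \neq 0$, and $\psi$ has finite limits in $-\infty$ and $\infty$; (E)(1) $0 \leq \gamma < 1/2$, $\mu \neq 0$, and $\psi$ has finite limits in $-\infty$ and $\infty$; (E)(2) $0 \leq \gamma < 1/2$, $\mu = 0$, and $\psi$ has coinciding finite limits in $-\infty$ and $\infty$. In particular, letting $\Phi$ be the standard normal cumulative distribution function, it holds for each real $x>0$ that $$\left|2 \Phi (x) - 1 - \mathbb{P}\left[\widehat{\mu}_{N_n} - \frac{\sigma}{\sqrt{N_n}} x \leq \mu \leq \widehat{\mu}_{N_n} + \frac{\sigma}{\sqrt{N_n}} x \right]\right| \rightarrow 0 \text{ as } n \rightarrow \infty$$ in each of the cases 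(A)--(E).
   Context: Setting. All random variables are defined on the same probability space. Fixed are: $\mu\in\mathbb{R}$; $\sigma>0$; a sequence $X_1,X_2,\ldots$ of i.i.d. random variables with law $N(\mu,\sigma^2)$; an integer $L\ge 1$; integers $0<k_1<k_2<\dots<k_{L+1}$; a Borel measurable map $\psi:\mathbb{R}\to[0,1]$; a real number $\gamma\ge 0$. For $m\ge 1$ put $K_m=\sum_{k=1}^m X_k$. For each integer $n\ge 1$, $N_n$ is a random sample size such that: - $N_n$ takes values in $\{k_1n,\ldots,k_{L+1}n\}$; - for each $i\in\{1,\ldots,L\}$, the event $\{N_n=k_in\}$ does not depend on $X_{k_in+1},X_{k_in+2},\ldots$, i.e. $\mathbb{P}[N_n=k_in\mid X_1,X_2,\ldots]=\mathbb{P}[N_n=k_in\mid X_1,\ldots,X_{k_in}]$ almost surely; - for each $i\in\{1,\ldots,L\}$, the stopping rule $$\mathbb{P}[N_n = k_i n \mid X_1, \ldots, X_{k_in }] = \psi\left(\frac{K_{k_i n}}{(k_in)^\gamma}\right) \prod_{j = 1}^{i - 1} \left(1 - \psi\left(\frac{K_{k_j n}}{(k_j n)^\gamma}\right)\right)$$ holds, the empty product being $1$. The total variation distance between real random variables $X$ and $Y$ is $d_{TV}(X,Y)=\sup_A|\mathbb{P}[X\in A]-\mathbb{P}[Y\in A]|$, the supremum running over all Borel sets $A\subset\mathbb{R}$. *)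

theory Defs
  imports "HOL-Probability.Probability"
begin

text \<open>The \<sigma>-algebra generated by the real random variables \<open>X i\<close>, \<open>i \<in> I\<close>, in the form of a
  measure space on \<open>space M\<close>, as \<^const>\<open>real_cond_exp\<close> expects. Only its collection of measurable
  sets matters.\<close>

definition gen_algebra :: "'a measure \<Rightarrow> (nat \<Rightarrow> 'a \<Rightarrow> real) \<Rightarrow> nat set \<Rightarrow> 'a measure" where
  "gen_algebra M X I = sigma (space M) (\<Union>i\<in>I. {X i -` A \<inter> space M | A. A \<in> sets borel})"

text \<open>\<open>\<P>[E | (X i) i \<in> I]\<close>, as a random variable. The result is one version of the conditional
  probability, so identities involving it are to be stated almost surely.\<close>

definition cond_prob_given ::
  "'a measure \<Rightarrow> (nat \<Rightarrow> 'a \<Rightarrow> real) \<Rightarrow> nat set \<Rightarrow> 'a set \<Rightarrow> 'a \<Rightarrow> real" where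
  "cond_prob_given M X I E = real_cond_exp M (gen_algebra M X I) (indicator E)"

definition partial_sum :: "(nat \<Rightarrow> 'a \<Rightarrow> real) \<Rightarrow> nat \<Rightarrow> 'a \<Rightarrow> real" where
  "partial_sum X m \<omega> = (\<Sum>k=1..m. X k \<omega>)"

definition sample_mean :: "(nat \<Rightarrow> 'a \<Rightarrow> real) \<Rightarrow> ('a \<Rightarrow> nat) \<Rightarrow> 'a \<Rightarrow> real" where
  "sample_mean X N \<omega> = partial_sum X (N \<omega>) \<omega> / real (N \<omega>)"

definition tv_dist :: "'a measure \<Rightarrow> ('a \<Rightarrow> real) \<Rightarrow> ('a \<Rightarrow> real) \<Rightarrow> real" where
  "tv_dist M X Y =
     (SUP A\<in>sets borel. \<bar>measure M {\<omega> \<in> space M. X \<omega> \<in> A} - measure M {\<omega> \<in> space M. Y \<omega> \<in> A}\<bar>)"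

text \<open>Limits of \<open>f\<close> at a point are punctured: the value of \<open>f\<close> at the point itself is irrelevant.\<close>

definition has_finite_limit :: "(real \<Rightarrow> real) \<Rightarrow> real filter \<Rightarrow> bool" where
  "has_finite_limit f F \<longleftrightarrow> (\<exists>l::real. (f \<longlongrightarrow> l) F)"

end

theory Submission
  imports Defs "HOL-Real_Asymp.Real_Asymp"
begin

text \<open>Write \<open>K m = m * \<mu> + \<sigma> * sqrt m * Z m\<close> with \<open>Z m\<close> standard normal. In each of the cases
  (A)--(E) the random variables \<open>\<psi> (K m / m powr \<gamma>)\<close> converge to one constant \<open>l\<close> in \<open>L\<^sup>1\<close>, by
  dominated convergence. Hence the conditional probability that \<open>N n = k i * n\<close>, given all the
  observations, converges in \<open>L\<^sup>1\<close> to the constant \<open>l * (1 - l) ^ (i - 1)\<close>, so that in the limit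
  the sample size is independent of the observations. Since every \<open>Z (k i * n)\<close> has the standard
  normal law, so has the standardized sample mean in the limit, with a total variation error of at
  most twice the sum of the \<open>L\<^sup>1\<close> errors.\<close>

section \<open>Conditional probabilities close to constants\<close>

text \<open>Since \<open>B\<close> lies in \<open>F\<close>, \<open>prob (E \<inter> B)\<close> is
  the integral of \<open>q\<close> over \<open>B\<close>. Subtracting \<open>c * prob B\<close>
  leaves the integral of \<open>q - c\<close> over \<open>B\<close>, which the \<open>L^1\<close>
  norm bounds. The bound is the same for all \<open>B\<close>; this uniformity is what later yields
  total variation.\<close>

lemma (in prob_space) cond_prob_near_const:
  assumes F: "subalgebra M F"
    and E: "E \<in> events" and B: "B \<in> sets F"
    and q [measurable]: "q \<in> borel_measurable M"
    and cond: "AE x in M. real_cond_exp M F (indicator E) x = q x"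
  shows "\<bar>prob (E \<inter> B) - c * prob B\<bar> \<le> expectation (\<lambda>x. \<bar>q x - c\<bar>)"
proof -
  interpret finite_measure_subalgebra M F
    using F by unfold_locales
  have BM [measurable]: "B \<in> events"
    using F B by (auto simp: subalgebra_def)
  have int_ind: "integrable M (indicator E :: _ \<Rightarrow> real)"
    using E by (simp add: integrable_indicator_iff less_top[symmetric])
  have "integrable M (real_cond_exp M F (indicator E))"
    using int_ind by (rule real_cond_exp_int(1))
  then have q_int: "integrable M q"
    using cond q by (simp cong: integrable_cong_AE)
  have "prob (E \<inter> B) = (\<integral>x\<in>B. indicator E x \<partial>M)"
    using E by (simp add: set_lebesgue_integral_def Int_commute flip: indicator_inter_arith)
  also have "\<dots> = (\<integral>x\<in>B. real_cond_exp M F (indicator E) x \<partial>M)"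
    using int_ind B by (rule real_cond_exp_intA)
  also have "\<dots> = (\<integral>x\<in>B. q x \<partial>M)"
    unfolding set_lebesgue_integral_def
    using cond by (intro integral_cong_AE) auto
  finally have "prob (E \<inter> B) - c * prob B = (\<integral>x\<in>B. q x \<partial>M) - (\<integral>x\<in>B. c \<partial>M)"
    by (simp add: set_lebesgue_integral_def mult.commute)
  also have "\<dots> = expectation (\<lambda>x. indicator B x * (q x - c))"
    unfolding set_lebesgue_integral_def
    using integrable_mult_indicator[OF BM q_int]
    by (subst Bochner_Integration.integral_diff[symmetric])
      (auto simp: right_diff_distrib integrable_indicator_iff less_top[symmetric])
  also have "\<bar>\<dots>\<bar> \<le> expectation (\<lambda>x. \<bar>indicator B x * (q x - c)\<bar>)"
    by (rule integral_abs_bound)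
  also have "\<dots> \<le> expectation (\<lambda>x. \<bar>q x - c\<bar>)"
    using q_int integrable_mult_indicator[OF BM, of "\<lambda>x. q x - c"]
    by (intro integral_mono) (auto simp: indicator_def)
  finally show ?thesis .
qed

text \<open>The event \<open>E r\<close> is treated as the complement of the other \<open>E i\<close>, and its contribution is
  rewritten using that all the \<open>B i\<close> have the same probability; this costs the factor \<open>2\<close>.\<close>

lemma (in prob_space) stopped_prob_near_const:
  assumes F: "subalgebra M F"
    and I: "finite I" "r \<notin> I"
    and E: "\<And>i. i \<in> insert r I \<Longrightarrow> E i \<in> events"
    and disj: "disjoint_family_on E (insert r I)"
    and cover: "(\<Union>i\<in>insert r I. E i) = space M"
    and B: "\<And>i. i \<in> insert r I \<Longrightarrow> B i \<in> sets F"
    and prob_B: "\<And>i. i \<in> insert r I \<Longrightarrow> prob (B i) = b"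
    and q: "\<And>i. i \<in> I \<Longrightarrow> q i \<in> borel_measurable M"
    and cond: "\<And>i. i \<in> I \<Longrightarrow> AE x in M. real_cond_exp M F (indicator (E i)) x = q i x"
  shows "\<bar>prob (\<Union>i\<in>insert r I. E i \<inter> B i) - b\<bar>
    \<le> 2 * (\<Sum>i\<in>I. expectation (\<lambda>x. \<bar>q i x - c i\<bar>))"
proof -
  have BM: "B i \<in> events" if "i \<in> insert r I" for i
    using F B that by (auto simp: subalgebra_def)
  have disj_Int: "disjoint_family_on (\<lambda>i. E i \<inter> C i) (insert r I)" for C
    using disj unfolding disjoint_family_on_def by blast
  have "b = prob (\<Union>i\<in>insert r I. E i \<inter> B r)"
  proof -
    have "B r = (\<Union>i\<in>insert r I. E i \<inter> B r)"
      using cover sets.sets_into_space[OF BM[of r]] by blast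
    then show ?thesis
      using prob_B[of r] by simp
  qed
  also have "\<dots> = (\<Sum>i\<in>insert r I. prob (E i \<inter> B r))"
    using I E BM disj_Int[of "\<lambda>_. B r"] by (intro finite_measure_finite_Union) auto
  finally have b: "b = prob (E r \<inter> B r) + (\<Sum>i\<in>I. prob (E i \<inter> B r))"
    using I by simp
  have "prob (\<Union>i\<in>insert r I. E i \<inter> B i) = (\<Sum>i\<in>insert r I. prob (E i \<inter> B i))"
    using I E BM disj_Int[of B] by (intro finite_measure_finite_Union) auto
  then have "prob (\<Union>i\<in>insert r I. E i \<inter> B i) - b
      = (\<Sum>i\<in>I. prob (E i \<inter> B i) - prob (E i \<inter> B r))"
    using I b by (simp add: sum_subtractf)
  also have "\<bar>\<dots>\<bar> \<le> (\<Sum>i\<in>I. 2 * expectation (\<lambda>x. \<bar>q i x - c i\<bar>))"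
  proof (rule order_trans[OF sum_abs], rule sum_mono)
    fix i assume i: "i \<in> I"
    \<comment> \<open>All \<open>B j\<close> share the probability \<open>b\<close>, so
      \<open>j = i\<close> and \<open>j = r\<close> are compared with the same number
      \<open>c i * b\<close>.\<close>
    have "\<bar>prob (E i \<inter> B j) - c i * b\<bar> \<le> expectation (\<lambda>x. \<bar>q i x - c i\<bar>)"
      if "j \<in> insert r I" for j
      using cond_prob_near_const[OF F, of "E i" "B j" "q i" "c i"] E[of i] B[of j] q[of i] cond[of i]
        prob_B[of j] i that by auto
    from this[of i] this[of r] i
    show "\<bar>prob (E i \<inter> B i) - prob (E i \<inter> B r)\<bar> \<le> 2 * expectation (\<lambda>x. \<bar>q i x - c i\<bar>)"
      by auto
  qed
  finally show ?thesis
    by (simp add: sum_distrib_left)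
qed

section \<open>Perturbation of the stopping weights\<close>

text \<open>Both weights are products of \<open>i\<close> factors in \<open>[0,1]\<close>, so their
  difference is at most the sum of the differences of the factors. Passing from \<open>a j\<close>
  to \<open>1 - a j\<close> does not change such a difference.\<close>

lemma abs_stopping_weight_diff_le:
  fixes a :: "nat \<Rightarrow> real"
  assumes "i \<ge> 1" and a: "\<And>j. 0 \<le> a j \<and> a j \<le> 1" and l: "0 \<le> l" "l \<le> 1"
  shows "\<bar>a i * (\<Prod>j\<in>{1..<i}. 1 - a j) - l * (1 - l) ^ (i - 1)\<bar> \<le> (\<Sum>j\<in>{1..i}. \<bar>a j - l\<bar>)"
proof -
  \<comment> \<open>The leading factor becomes the one with index \<open>i\<close>, which turns each
    weight into a single product over \<open>{1..i}\<close> as \<open>norm_prod_diff\<close>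
    requires.\<close>
  define b where "b j = (if j = i then a j else 1 - a j)" for j
  define m where "m j = (if j = i then l else 1 - l)" for j
  have upto: "{1..i} = insert i {1..<i}"
    using \<open>i \<ge> 1\<close> by auto
  have "(\<Prod>j\<in>{1..<i}. b j) = (\<Prod>j\<in>{1..<i}. 1 - a j)"
    by (auto simp: b_def intro!: prod.cong)
  then have "(\<Prod>j\<in>{1..i}. b j) = a i * (\<Prod>j\<in>{1..<i}. 1 - a j)"
    unfolding upto by (simp add: b_def)
  moreover have "(\<Prod>j\<in>{1..<i}. m j) = (\<Prod>j\<in>{1..<i}. 1 - l)"
    by (auto simp: m_def intro!: prod.cong)
  then have "(\<Prod>j\<in>{1..i}. m j) = l * (1 - l) ^ (i - 1)"
    unfolding upto by (simp add: m_def)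
  moreover have "norm ((\<Prod>j\<in>{1..i}. b j) - (\<Prod>j\<in>{1..i}. m j)) \<le> (\<Sum>j\<in>{1..i}. norm (b j - m j))"
    using a l by (intro norm_prod_diff) (auto simp: b_def m_def)
  moreover have "norm (b j - m j) = \<bar>a j - l\<bar>" for j
    by (auto simp: b_def m_def)
  ultimately show ?thesis
    by simp
qed

section \<open>Standard normal laws\<close>

lemma (in prob_space) standardized_partial_sum:
  assumes "\<sigma> > 0" "m \<ge> 1"
    and X_indep: "indep_vars (\<lambda>_. borel) X {1..}"
    and X_normal: "\<And>j. j \<ge> 1 \<Longrightarrow> distributed M lborel (X j) (normal_density \<mu> \<sigma>)"
  shows "distributed M lborel (\<lambda>\<omega>. (partial_sum X m \<omega> - real m * \<mu>) / (\<sigma> * sqrt (real m)))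
    std_normal_density"
proof -
  have "distributed M lborel (\<lambda>\<omega>. \<Sum>j\<in>{1..m}. X j \<omega>)
      (normal_density (\<Sum>j\<in>{1..m}. \<mu>) (sqrt (\<Sum>j\<in>{1..m}. \<sigma>\<^sup>2)))"
    using assms by (intro sum_indep_normal indep_vars_subset[OF X_indep]) auto
  then have "distributed M lborel (partial_sum X m) (normal_density (real m * \<mu>) (\<sigma> * sqrt (real m)))"
    using \<open>\<sigma> > 0\<close> by (simp add: partial_sum_def[abs_def] real_sqrt_mult mult.commute)
  then show ?thesis
    using assms by (subst (asm) normal_standard_normal_convert) auto
qed

text \<open>The event \<open>\<xi> < -x\<close> is the complement of \<open>-\<xi> \<le> x\<close>,
  and \<open>-\<xi>\<close> is again standard normal. Removing it from \<open>\<xi> \<le> x\<close>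
  therefore leaves \<open>cdf x - (1 - cdf x)\<close>.\<close>

lemma (in prob_space) prob_std_normal_symmetric_interval:
  assumes \<xi>: "distributed M lborel \<xi> std_normal_density" and "x > 0"
  shows "prob {\<omega> \<in> space M. \<xi> \<omega> \<in> {-x..x}} = 2 * cdf std_normal_distribution x - 1"
proof -
  have cdf_eq: "prob {\<omega> \<in> space M. Y \<omega> \<le> x} = cdf std_normal_distribution x"
    if "distributed M lborel Y std_normal_density" for Y
    using distributed_measurable[OF that] distributed_distr_eq_density[OF that, symmetric]
    by (simp add: cdf_def measure_distr vimage_def Int_def conj_commute)
  have [measurable]: "\<xi> \<in> borel_measurable M"
    using distributed_measurable[OF \<xi>] by simp
  have neg: "distributed M lborel (\<lambda>\<omega>. - \<xi> \<omega>) std_normal_density"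
    using normal_density_affine[OF \<xi>, of "-1" 0] by simp
  have "prob {\<omega> \<in> space M. \<xi> \<omega> \<in> {-x..x}}
      = prob ({\<omega> \<in> space M. \<xi> \<omega> \<le> x} - (space M - {\<omega> \<in> space M. - \<xi> \<omega> \<le> x}))"
    by (intro arg_cong[where f = prob]) auto
  also have "\<dots> = prob {\<omega> \<in> space M. \<xi> \<omega> \<le> x} - prob (space M - {\<omega> \<in> space M. - \<xi> \<omega> \<le> x})"
    using \<open>x > 0\<close> by (intro finite_measure_Diff) auto
  also have "prob (space M - {\<omega> \<in> space M. - \<xi> \<omega> \<le> x}) = 1 - prob {\<omega> \<in> space M. - \<xi> \<omega> \<le> x}"
    by (intro prob_compl) measurable
  finally show ?thesis
    using cdf_eq[OF \<xi>] cdf_eq[OF neg] by simp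
qed

section \<open>Convergence of the stopping probabilities\<close>

text \<open>With \<open>z\<close> the standardized partial sum, \<open>partial_sum X m = m * \<mu> + \<sigma> * sqrt m * z\<close>.
  The point \<open>z = 0\<close> is excluded because the limits of \<open>\<psi>\<close> at \<open>0\<close> and \<open>\<mu>\<close> are
  punctured, and because for \<open>\<gamma> < 1/2\<close> and \<open>\<mu> = 0\<close> the argument of \<open>\<psi>\<close> diverges only if
  \<open>z \<noteq> 0\<close>.\<close>

lemma stopping_probability_tendsto:
  fixes \<mu> \<sigma> \<gamma> :: real and \<psi> :: "real \<Rightarrow> real"
  assumes "\<sigma> > 0"
    and "(\<gamma> > 1 \<and> has_finite_limit \<psi> (at 0))
     \<or> (\<gamma> = 1 \<and> has_finite_limit \<psi> (at \<mu>))
     \<or> (\<gamma> < 1 \<and> \<mu> \<noteq> 0 \<and> has_finite_limit \<psi> at_bot \<and> has_finite_limit \<psi> at_top)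
     \<or> (1/2 < \<gamma> \<and> \<mu> = 0 \<and> has_finite_limit \<psi> (at 0))
     \<or> (\<gamma> < 1/2 \<and> \<mu> = 0 \<and> (\<exists>l::real. (\<psi> \<longlongrightarrow> l) at_bot \<and> (\<psi> \<longlongrightarrow> l) at_top))"
  shows "\<exists>l. \<forall>z. z \<noteq> 0 \<longrightarrow>
    (\<lambda>m. \<psi> ((real m * \<mu> + \<sigma> * sqrt (real m) * z) / real m powr \<gamma>)) \<longlonglongrightarrow> l"
proof -
  let ?x = "\<lambda>z m. (real m * \<mu> + \<sigma> * sqrt (real m) * z) / real m powr \<gamma>"
  have lim: ?thesis
    if lim: "has_finite_limit \<psi> F" "\<And>z. z \<noteq> 0 \<Longrightarrow> filterlim (?x z) F sequentially" for F
  proof -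
    obtain l where l: "(\<psi> \<longlongrightarrow> l) F"
      using lim(1) by (auto simp: has_finite_limit_def)
    then show ?thesis
      using filterlim_compose[OF l lim(2)] by blast
  qed
  from assms(2) show ?thesis
  proof (elim disjE conjE exE)
    \<comment> \<open>The argument is \<open>\<mu> * m powr (1 - \<gamma>) + \<sigma> * z * m powr
      (1/2 - \<gamma>)\<close>. Here both exponents are negative, and the signs of
      \<open>\<mu>\<close> and \<open>z\<close> tell from which side 0 is approached.\<close>
    assume "\<gamma> > 1" and lim_0: "has_finite_limit \<psi> (at 0)"
    have "filterlim (?x z) (at 0) sequentially" if "z \<noteq> 0" for z
      using \<open>\<gamma> > 1\<close> that \<open>\<sigma> > 0\<close>
      by (cases "\<mu> = 0"; cases "\<mu> > 0"; cases "z > 0"; simp; real_asymp)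
    with lim_0 show ?thesis by (rule lim)
  next
    assume "\<gamma> = 1" and lim_\<mu>: "has_finite_limit \<psi> (at \<mu>)"
    have "filterlim (?x z) (at \<mu>) sequentially" if "z \<noteq> 0" for z
      using \<open>\<gamma> = 1\<close> that \<open>\<sigma> > 0\<close> by (cases "z > 0"; simp; real_asymp)
    with lim_\<mu> show ?thesis by (rule lim)
  next
    \<comment> \<open>This covers (C)(1), (D) and (E)(1) together: the drift exceeds the fluctuation
      by a factor of order \<open>sqrt m\<close>, so the sign of \<open>\<mu>\<close> alone selects
      the tail of \<open>\<psi>\<close>.\<close>
    assume "\<gamma> < 1" "\<mu> \<noteq> 0"
      and lims: "has_finite_limit \<psi> at_bot" "has_finite_limit \<psi> at_top"
    have "filterlim (?x z) (if \<mu> > 0 then at_top else at_bot) sequentially" if "z \<noteq> 0" for z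
      using \<open>\<gamma> < 1\<close> \<open>\<mu> \<noteq> 0\<close> that \<open>\<sigma> > 0\<close>
      by (cases "\<mu> > 0"; cases "z > 0"; simp; real_asymp)
    with lims show ?thesis by (intro lim[of "if \<mu> > 0 then at_top else at_bot"]) auto
  next
    assume "1/2 < \<gamma>" "\<mu> = 0" and lim_0: "has_finite_limit \<psi> (at 0)"
    have "filterlim (?x z) (at 0) sequentially" if "z \<noteq> 0" for z
      using \<open>1/2 < \<gamma>\<close> \<open>\<mu> = 0\<close> that \<open>\<sigma> > 0\<close> by (cases "z > 0"; simp; real_asymp)
    with lim_0 show ?thesis by (rule lim)
  next
    fix l
    assume "\<gamma> < 1/2" "\<mu> = 0" and "(\<psi> \<longlongrightarrow> l) at_bot" "(\<psi> \<longlongrightarrow> l) at_top"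
    \<comment> \<open>Without drift the sign of \<open>z\<close> selects the tail. One limit for all
      \<open>z\<close> thus requires equal limits in both tails, that is, a limit along
      \<open>at_infinity\<close>.\<close>
    then have lim_inf: "has_finite_limit \<psi> at_infinity"
      unfolding has_finite_limit_def at_infinity_eq_at_top_bot by (blast intro: filterlim_sup)
    have "filterlim (?x z) at_infinity sequentially" if "z \<noteq> 0" for z
      using \<open>\<gamma> < 1/2\<close> \<open>\<mu> = 0\<close> that \<open>\<sigma> > 0\<close> by (cases "z > 0"; simp; real_asymp)
    with lim_inf show ?thesis by (rule lim)
  qed
qed

text \<open>All \<open>Z m\<close> have the same law, so the expectations are integrals against one
  fixed density and only the marginal laws enter. Dominated convergence applies, the excluded point
  0 being a null set.\<close>

lemma (in prob_space) expectation_abs_diff_std_normal_tendsto_0: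
  fixes g :: "nat \<Rightarrow> real \<Rightarrow> real"
  assumes Z: "\<And>m. m \<ge> 1 \<Longrightarrow> distributed M lborel (Z m) std_normal_density"
    and g [measurable]: "\<And>m. g m \<in> borel_measurable borel"
    and bound: "\<And>m z. \<bar>g m z\<bar> \<le> C"
    and lim: "\<And>z. z \<noteq> 0 \<Longrightarrow> (\<lambda>m. g m z) \<longlonglongrightarrow> l"
  shows "(\<lambda>m. expectation (\<lambda>\<omega>. \<bar>g m (Z m \<omega>) - l\<bar>)) \<longlonglongrightarrow> 0"
proof -
  have "(\<lambda>m. \<integral>z. std_normal_density z * \<bar>g m z - l\<bar> \<partial>lborel) \<longlonglongrightarrow> (\<integral>z. 0 \<partial>(lborel :: real measure))"
  proof (rule integral_dominated_convergence)
    show "integrable lborel (\<lambda>z. std_normal_density z * (C + \<bar>l\<bar>))"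
      by (intro integrable_mult_left) (simp add: integrable_normal_density)
    show "AE z in lborel. (\<lambda>m. std_normal_density z * \<bar>g m z - l\<bar>) \<longlonglongrightarrow> 0"
      using AE_lborel_singleton[of 0]
    proof eventually_elim
      case (elim z)
      then show ?case
        using tendsto_mult_right_zero[OF tendsto_rabs_zero[OF LIM_zero[OF lim[of z]]]] by simp
    qed
    show "AE z in lborel. norm (std_normal_density z * \<bar>g m z - l\<bar>) \<le> std_normal_density z * (C + \<bar>l\<bar>)" for m
    proof (rule AE_I2)
      fix z
      have "\<bar>g m z - l\<bar> \<le> C + \<bar>l\<bar>"
        using bound[of m z] abs_triangle_ineq4[of "g m z" l] by linarith
      then show "norm (std_normal_density z * \<bar>g m z - l\<bar>) \<le> std_normal_density z * (C + \<bar>l\<bar>)"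
        by (simp add: abs_mult mult_left_mono)
    qed
  qed measurable
  then have "(\<lambda>m. \<integral>z. std_normal_density z * \<bar>g m z - l\<bar> \<partial>lborel) \<longlonglongrightarrow> 0"
    by simp
  then show ?thesis
  proof (rule Lim_transform_eventually)
    show "\<forall>\<^sub>F m in sequentially. (\<integral>z. std_normal_density z * \<bar>g m z - l\<bar> \<partial>lborel)
        = expectation (\<lambda>\<omega>. \<bar>g m (Z m \<omega>) - l\<bar>)"
      using eventually_ge_at_top[of 1]
          proof eventually_elim
      case (elim m)
      show ?case
        using distributed_integral[OF Z[OF elim], of "\<lambda>z. \<bar>g m z - l\<bar>"] by simp
    qed
  qed
qed

section \<open>The algebra generated by the observations\<close>

lemma measurable_gen_algebra:
  assumes "i \<in> I" "X i \<in> borel_measurable M"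
  shows "X i \<in> borel_measurable (gen_algebra M X I)"
  using assms unfolding gen_algebra_def
  by (intro measurableI) (auto simp: space_measure_of_conv intro!: in_measure_of)

lemma subalgebra_gen_algebra:
  assumes "\<And>i. i \<in> I \<Longrightarrow> X i \<in> borel_measurable M"
  shows "subalgebra M (gen_algebra M X I)"
proof -
  have "(\<Union>i\<in>I. {X i -` A \<inter> space M | A. A \<in> sets borel}) \<subseteq> sets M"
    using assms by (auto intro: measurable_sets)
  then have "sigma_sets (space M) (\<Union>i\<in>I. {X i -` A \<inter> space M | A. A \<in> sets borel}) \<subseteq> sets M"
    by (rule sets.sigma_sets_subset)
  then show ?thesis
    by (auto simp: subalgebra_def gen_algebra_def space_measure_of_conv sets_measure_of_conv)
qed

section \<open>Convergence in total variation and of the coverage probability\<close>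

theorem theorem6:
  fixes M :: "'a measure"
    and \<mu> \<sigma> \<gamma> :: real
    and X :: "nat \<Rightarrow> 'a \<Rightarrow> real"
    and L :: nat
    and k :: "nat \<Rightarrow> nat"
    and \<psi> :: "real \<Rightarrow> real"
    and N :: "nat \<Rightarrow> 'a \<Rightarrow> nat"
    and \<xi> :: "'a \<Rightarrow> real"
  assumes "prob_space M"
    and "\<sigma> > 0"
    and X_indep: "prob_space.indep_vars M (\<lambda>_. borel) X {1..}"
    and X_normal: "\<And>j. j \<ge> 1 \<Longrightarrow> distributed M lborel (X j) (normal_density \<mu> \<sigma>)"
    and "L \<ge> 1"
    and "0 < k 1"
    and "strict_mono_on {1..L+1} k"
    and "\<psi> \<in> borel_measurable borel"
    and "\<And>x. 0 \<le> \<psi> x \<and> \<psi> x \<le> 1"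
    and "\<gamma> \<ge> 0"
    and N_meas: "\<And>n. n \<ge> 1 \<Longrightarrow> N n \<in> measurable M (count_space UNIV)"
    and N_range: "\<And>n \<omega>. n \<ge> 1 \<Longrightarrow> \<omega> \<in> space M \<Longrightarrow> N n \<omega> \<in> {k i * n | i. i \<in> {1..L+1}}"
    and N_indep_future: "\<And>n i. n \<ge> 1 \<Longrightarrow> i \<in> {1..L} \<Longrightarrow>
          AE \<omega> in M. cond_prob_given M X {1..} {\<omega>' \<in> space M. N n \<omega>' = k i * n} \<omega>
                   = cond_prob_given M X {1..k i * n} {\<omega>' \<in> space M. N n \<omega>' = k i * n} \<omega>"
    and stopping_rule: "\<And>n i. n \<ge> 1 \<Longrightarrow> i \<in> {1..L} \<Longrightarrow>
          AE \<omega> in M. cond_prob_given M X {1..k i * n} {\<omega>' \<in> space M. N n \<omega>' = k i * n} \<omega>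
                   = \<psi> (partial_sum X (k i * n) \<omega> / real (k i * n) powr \<gamma>) *
                     (\<Prod>j\<in>{1..<i}. 1 - \<psi> (partial_sum X (k j * n) \<omega> / real (k j * n) powr \<gamma>))"
    and \<xi>_std_normal: "distributed M lborel \<xi> std_normal_density"
    and cases_A_to_E:
      "(\<gamma> > 1 \<and> has_finite_limit \<psi> (at 0))
     \<or> (\<gamma> = 1 \<and> has_finite_limit \<psi> (at \<mu>))
     \<or> (1/2 < \<gamma> \<and> \<gamma> < 1 \<and> \<mu> \<noteq> 0 \<and> has_finite_limit \<psi> at_bot \<and> has_finite_limit \<psi> at_top)
     \<or> (1/2 < \<gamma> \<and> \<gamma> < 1 \<and> \<mu> = 0 \<and> has_finite_limit \<psi> (at 0))
     \<or> (\<gamma> = 1/2 \<and> \<mu> \<noteq> 0 \<and> has_finite_limit \<psi> at_bot \<and> has_finite_limit \<psi> at_top)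
     \<or> (0 \<le> \<gamma> \<and> \<gamma> < 1/2 \<and> \<mu> \<noteq> 0 \<and> has_finite_limit \<psi> at_bot \<and> has_finite_limit \<psi> at_top)
     \<or> (0 \<le> \<gamma> \<and> \<gamma> < 1/2 \<and> \<mu> = 0 \<and> (\<exists>l::real. (\<psi> \<longlongrightarrow> l) at_bot \<and> (\<psi> \<longlongrightarrow> l) at_top))"
  shows "(\<lambda>n. tv_dist M \<xi> (\<lambda>\<omega>. sqrt (real (N n \<omega>)) / \<sigma> * (sample_mean X (N n) \<omega> - \<mu>)))
           \<longlonglongrightarrow> 0
       \<and> (\<forall>x::real. x > 0 \<longrightarrow>
           (\<lambda>n. \<bar>2 * cdf std_normal_distribution x - 1
                 - measure M {\<omega> \<in> space M.
                     sample_mean X (N n) \<omega> - \<sigma> / sqrt (real (N n \<omega>)) * x \<le> \<mu> \<and>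
                     \<mu> \<le> sample_mean X (N n) \<omega> + \<sigma> / sqrt (real (N n \<omega>)) * x}\<bar>)
           \<longlonglongrightarrow> 0)"

proof -
  interpret prob_space M by fact
  define a where "a m \<omega> = \<psi> (partial_sum X m \<omega> / real m powr \<gamma>)" for m \<omega>
  have a_bounds: "0 \<le> a m \<omega> \<and> a m \<omega> \<le> 1" for m \<omega>
    using assms(9) by (simp add: a_def)
  define q where "q n i \<omega> = a (k i * n) \<omega> * (\<Prod>j\<in>{1..<i}. 1 - a (k j * n) \<omega>)" for n i \<omega>
  define Z where "Z m \<omega> = (partial_sum X m \<omega> - real m * \<mu>) / (\<sigma> * sqrt (real m))" for m \<omega>
  define T where "T n \<omega> = sqrt (real (N n \<omega>)) / \<sigma> * (sample_mean X (N n) \<omega> - \<mu>)" for n \<omega>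
  \<comment> \<open>Conditioning is on all observations, so that \<open>G\<close> contains the
    events about every \<open>Z (k i * n)\<close>, including those that depend on observations made
    after the stopping time considered.\<close>
  define G where "G = gen_algebra M X {1..}"
  note \<psi>_bounds = assms(9)
  have [measurable]: "\<psi> \<in> borel_measurable borel" by fact
  have X_meas [measurable]: "X j \<in> borel_measurable M" if "j \<ge> 1" for j
    using distributed_measurable[OF X_normal[OF that]] by simp
  have G: "subalgebra M G"
    unfolding G_def by (intro subalgebra_gen_algebra) auto
  have K_G: "partial_sum X m \<in> borel_measurable G" for m
    unfolding partial_sum_def[abs_def] G_def
    by (intro borel_measurable_sum measurable_gen_algebra) auto
  then have [measurable]: "partial_sum X m \<in> borel_measurable M" for m
    using measurable_from_subalg[OF G] by blast
  have [measurable]: "a m \<in> borel_measurable M" for m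
    unfolding a_def[abs_def] by measurable
  have q_meas: "q n i \<in> borel_measurable M" for n i
    unfolding q_def[abs_def] by measurable
  have k_less: "k i < k j" if "i \<in> {1..L+1}" "j \<in> {1..L+1}" "i < j" for i j
    using assms(7) that by (auto simp: strict_mono_on_def)
  have k_pos: "k i > 0" if "i \<in> {1..L+1}" for i
    using k_less[of 1 i] that \<open>0 < k 1\<close> by (cases "i = 1") auto
  have Z_normal: "distributed M lborel (Z m) std_normal_density" if "m \<ge> 1" for m
    unfolding Z_def[abs_def] using standardized_partial_sum[OF \<open>\<sigma> > 0\<close> that X_indep X_normal] .
  have same_law: "prob {\<omega> \<in> space M. Y \<omega> \<in> A} = measure std_normal_distribution A"
    if "A \<in> sets borel" "distributed M lborel Y std_normal_density" for Y A
    using distributed_measurable[OF that(2)] distributed_distr_eq_density[OF that(2), symmetric] that(1)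
    by (simp add: measure_distr vimage_def Int_def conj_commute)
  have T_eq: "T n \<omega> = Z (N n \<omega>) \<omega>" if "N n \<omega> \<ge> 1" for n \<omega>
  proof -
    have "sqrt (real (N n \<omega>)) * sqrt (real (N n \<omega>)) = real (N n \<omega>)" "sqrt (real (N n \<omega>)) > 0"
      using that by auto
    then show ?thesis
      using that \<open>\<sigma> > 0\<close> by (simp add: T_def Z_def sample_mean_def field_simps)
  qed

  \<comment> \<open>The distinction of the cases (A)--(E) ends here; the rest uses only
    \<open>l\<close>.\<close>
  obtain l where l: "\<And>z. z \<noteq> 0 \<Longrightarrow>
      (\<lambda>m. \<psi> ((real m * \<mu> + \<sigma> * sqrt (real m) * z) / real m powr \<gamma>)) \<longlonglongrightarrow> l"
  proof -
    have "\<exists>l. \<forall>z. z \<noteq> 0 \<longrightarrow>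
        (\<lambda>m. \<psi> ((real m * \<mu> + \<sigma> * sqrt (real m) * z) / real m powr \<gamma>)) \<longlonglongrightarrow> l"
      using cases_A_to_E by (intro stopping_probability_tendsto[OF \<open>\<sigma> > 0\<close>]) auto
    then show thesis
      using that by blast
  qed
  have l_bounds: "0 \<le> l" "l \<le> 1"
    using LIMSEQ_le_const[OF l[of 1], of 0] LIMSEQ_le_const2[OF l[of 1], of 1] \<psi>_bounds by simp_all
  \<comment> \<open>At \<open>m = 0\<close> both numerators vanish, so the identity holds for all
    \<open>m\<close> and can be used to rewrite under \<open>e\<close>.\<close>
  have a_Z: "a m \<omega> = \<psi> ((real m * \<mu> + \<sigma> * sqrt (real m) * Z m \<omega>) / real m powr \<gamma>)" for m \<omega>
    using \<open>\<sigma> > 0\<close> by (cases "m = 0") (auto simp: a_def Z_def partial_sum_def)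
  define e where "e m = expectation (\<lambda>\<omega>. \<bar>a m \<omega> - l\<bar>)" for m
  have "e \<longlonglongrightarrow> 0"
    unfolding e_def[abs_def] a_Z
    using Z_normal l \<psi>_bounds by (intro expectation_abs_diff_std_normal_tendsto_0[where C = 1]) auto
  \<comment> \<open>The \<open>i\<close>-th weight involves the stopping probabilities with index
    \<open>j \<le> i\<close>, hence the inner sum; the factor 2 is that of
    \<open>stopped_prob_near_const\<close>.\<close>
  define d where "d n = 2 * (\<Sum>i\<in>{1..L}. \<Sum>j\<in>{1..i}. e (k j * n))" for n
  have "(\<lambda>n. e (k j * n)) \<longlonglongrightarrow> 0" if "j \<in> {1..L+1}" for j
    using filterlim_compose[OF \<open>e \<longlonglongrightarrow> 0\<close> filterlim_subseq[of "\<lambda>n. k j * n"]] k_pos[OF that]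
    by (auto simp: strict_mono_def)
  then have d_lim: "d \<longlonglongrightarrow> 0"
    unfolding d_def[abs_def] by (intro tendsto_mult_right_zero tendsto_null_sum) auto

  \<comment> \<open>The bound \<open>d n\<close> is the same for all Borel sets \<open>A\<close>, so
    it passes to the supremum.\<close>
  have close: "\<bar>prob {\<omega> \<in> space M. \<xi> \<omega> \<in> A} - prob {\<omega> \<in> space M. T n \<omega> \<in> A}\<bar> \<le> d n"
    if A: "A \<in> sets borel" and n: "n \<ge> 1" for A n
  proof -
    define E where "E i = {\<omega> \<in> space M. N n \<omega> = k i * n}" for i
    define B where "B i = {\<omega> \<in> space M. Z (k i * n) \<omega> \<in> A}" for i
    have [measurable]: "N n \<in> measurable M (count_space UNIV)"
      using n by (rule N_meas)
    have I: "insert (L+1) {1..L} = {1..L+1}"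
      by auto
    have cover: "(\<Union>i\<in>{1..L+1}. E i) = space M"
      using N_range[OF n] by (fastforce simp: E_def)
    have "inj_on k {1..L+1}"
      using assms(7) by (rule strict_mono_on_imp_inj_on)
    then have disj: "disjoint_family_on E {1..L+1}"
      using n by (auto simp: disjoint_family_on_def E_def inj_on_def)
    have Z_G: "Z m \<in> borel_measurable G" for m
      using K_G[of m] unfolding Z_def[abs_def] by measurable
    have "space G = space M"
      using G by (simp add: subalgebra_def)
    then have B_G: "B i \<in> sets G" for i
      using measurable_sets[OF Z_G A, of "k i * n"] by (simp add: B_def vimage_def Int_def conj_commute)
    have cond: "AE \<omega> in M. real_cond_exp M G (indicator (E i)) \<omega> = q n i \<omega>" if "i \<in> {1..L}" for i
      using N_indep_future[OF n that] stopping_rule[OF n that]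
      by eventually_elim (simp add: cond_prob_given_def G_def E_def q_def a_def)
    \<comment> \<open>The stopping rule is prescribed for \<open>i \<le> L\<close> only. The last
      index \<open>L+1\<close> takes the role of \<open>r\<close>, its event being the complement of
      the others.\<close>
    have "\<bar>prob (\<Union>i\<in>insert (L+1) {1..L}. E i \<inter> B i) - prob {\<omega> \<in> space M. \<xi> \<omega> \<in> A}\<bar>
        \<le> 2 * (\<Sum>i\<in>{1..L}. expectation (\<lambda>\<omega>. \<bar>q n i \<omega> - l * (1 - l) ^ (i - 1)\<bar>))"
    proof (rule stopped_prob_near_const[OF G])
      show "prob (B i) = prob {\<omega> \<in> space M. \<xi> \<omega> \<in> A}" if "i \<in> insert (L+1) {1..L}" for i
        using same_law[OF A Z_normal[of "k i * n"]] same_law[OF A \<xi>_std_normal] k_pos[of i] that n I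
        by (auto simp: B_def Suc_le_eq)
      show "E i \<in> events" for i
        unfolding E_def by measurable
    qed (use disj cover B_G q_meas cond in \<open>simp_all only: I finite_atLeastAtMost, simp_all\<close>)
    also have "(\<Union>i\<in>insert (L+1) {1..L}. E i \<inter> B i) = {\<omega> \<in> space M. T n \<omega> \<in> A}"
    proof -
      \<comment> \<open>On \<open>E i\<close> the random index \<open>N n\<close> is frozen at
        \<open>k i * n\<close>, where \<open>T n\<close> and \<open>Z (k i * n)\<close>
        agree.\<close>
      have "\<omega> \<in> B i \<longleftrightarrow> T n \<omega> \<in> A" if "i \<in> {1..L+1}" "\<omega> \<in> E i" for i \<omega>
        using that k_pos[OF that(1)] n T_eq[of n \<omega>] by (auto simp: B_def E_def Suc_le_eq)
      then have "(\<Union>i\<in>{1..L+1}. E i \<inter> B i) = (\<Union>i\<in>{1..L+1}. E i) \<inter> {\<omega>. T n \<omega> \<in> A}"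
        by blast
      then show ?thesis
        unfolding I cover by auto
    qed
    also have "2 * (\<Sum>i\<in>{1..L}. expectation (\<lambda>\<omega>. \<bar>q n i \<omega> - l * (1 - l) ^ (i - 1)\<bar>)) \<le> d n"
      unfolding d_def
    proof (intro mult_left_mono sum_mono)
      fix i assume i: "i \<in> {1..L}"
      have int: "integrable M (\<lambda>\<omega>. \<bar>a m \<omega> - l\<bar>)" for m
        using \<psi>_bounds l_bounds
        by (intro integrable_const_bound[where B = 1])
          (auto simp: a_def abs_le_iff intro!: AE_I2 add_increasing2 diff_le_eq[THEN iffD2])
      have "expectation (\<lambda>\<omega>. \<bar>q n i \<omega> - l * (1 - l) ^ (i - 1)\<bar>)
          \<le> expectation (\<lambda>\<omega>. \<Sum>j\<in>{1..i}. \<bar>a (k j * n) \<omega> - l\<bar>)"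
        unfolding q_def using i a_bounds l_bounds
        by (intro integral_mono' Bochner_Integration.integrable_sum int abs_stopping_weight_diff_le)
          auto
      also have "\<dots> = (\<Sum>j\<in>{1..i}. e (k j * n))"
        unfolding e_def using int by (intro Bochner_Integration.integral_sum)
      finally show "expectation (\<lambda>\<omega>. \<bar>q n i \<omega> - l * (1 - l) ^ (i - 1)\<bar>)
          \<le> (\<Sum>j\<in>{1..i}. e (k j * n))" .
    qed simp
    finally show ?thesis
      by (simp add: abs_minus_commute)
  qed

  have "(\<lambda>n. tv_dist M \<xi> (T n)) \<longlonglongrightarrow> 0"
  proof (rule tendsto_sandwich[OF _ _ tendsto_const d_lim])
    let ?D = "\<lambda>n A. \<bar>prob {\<omega> \<in> space M. \<xi> \<omega> \<in> A} - prob {\<omega> \<in> space M. T n \<omega> \<in> A}\<bar>"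
    show "\<forall>\<^sub>F n in sequentially. tv_dist M \<xi> (T n) \<le> d n"
      using eventually_ge_at_top[of 1]
      by eventually_elim (auto simp: tv_dist_def intro!: cSUP_least close)
    show "\<forall>\<^sub>F n in sequentially. 0 \<le> tv_dist M \<xi> (T n)"
      using eventually_ge_at_top[of 1]
    proof eventually_elim
      case (elim n)
      \<comment> \<open>The empty set contributes the value 0, and \<open>close\<close> provides the
        upper bound under which the supremum dominates each member.\<close>
      have "?D n {} \<le> tv_dist M \<xi> (T n)"
        unfolding tv_dist_def using close[OF _ elim] by (intro cSUP_upper) (auto intro!: bdd_aboveI2)
      then show ?case by simp
    qed
  qed
  moreover have "(\<lambda>n. \<bar>2 * cdf std_normal_distribution x - 1
        - prob {\<omega> \<in> space M.
            sample_mean X (N n) \<omega> - \<sigma> / sqrt (real (N n \<omega>)) * x \<le> \<mu> \<and>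
            \<mu> \<le> sample_mean X (N n) \<omega> + \<sigma> / sqrt (real (N n \<omega>)) * x}\<bar>) \<longlonglongrightarrow> 0"
    (is "(\<lambda>n. ?D n) \<longlonglongrightarrow> 0") if "x > 0" for x
  proof (rule tendsto_sandwich[OF _ _ tendsto_const d_lim])
    show "\<forall>\<^sub>F n in sequentially. ?D n \<le> d n"
      using eventually_ge_at_top[of 1]
    proof eventually_elim
      case (elim n)
      \<comment> \<open>Positivity lets the inequalities be multiplied by \<open>sqrt (N n)\<close>,
        which turns coverage of \<open>\<mu>\<close> into \<open>T n\<close> lying in
        \<open>{-x..x}\<close>. The bound \<open>close\<close> for this interval then finishes the
        proof.\<close>
      have "N n \<omega> > 0" if "\<omega> \<in> space M" for \<omega>
        using N_range[OF elim that] k_pos elim by auto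
      then have "{\<omega> \<in> space M.
            sample_mean X (N n) \<omega> - \<sigma> / sqrt (real (N n \<omega>)) * x \<le> \<mu> \<and>
            \<mu> \<le> sample_mean X (N n) \<omega> + \<sigma> / sqrt (real (N n \<omega>)) * x}
          = {\<omega> \<in> space M. T n \<omega> \<in> {-x..x}}"
        using \<open>\<sigma> > 0\<close> by (intro Collect_cong conj_cong refl) (auto simp: T_def field_simps)
      then show ?case
        using close[OF _ elim, of "{-x..x}"] prob_std_normal_symmetric_interval[OF \<xi>_std_normal that]
        by simp
    qed
  qed simp
  ultimately show ?thesis
    unfolding T_def by blast
qed

end
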